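(* Let $(M,g)$ be a finite-dimensional Riemannian manifold, $\phi$ a retraction on $M$, $c:M\times M\to M$ a map with $c(p,p)=p$ for all $p\in M$, $V:M\to\mathbb{R}$ a differentiable function, and $\overline{\mathrm{grad}}V$ a discrete Riemannian gradient of $V$ with respect to $\phi$ and $c$. Let $\tau_k>0$ for $k\in\mathbb{N}$, and let $\{u^k\}_{k\in\mathbb{N}}\subset M$ be a sequence generated by the discrete Riemannian gradient scheme: for every $k\in\mathbb{N}$, with $c^k=c(u^k,u^{k+1})$, $$u^{k+1}=\phi_{c^k}\big(W(u^k,u^{k+1})\big),\qquad W(u^k,u^{k+1})=\phi_{c^k}^{-1}(u^k)-\tau_k\,\overline{\mathrm{grad}}V(u^k,u^{k+1}).$$ Then $V(u^{k+1})-V(u^k)\le0$ for all $k\in\mathbb{N}$.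
   Context: $\mathrm{grad}V$ is the Riemannian gradient: $g(\mathrm{grad}V,X)=\mathrm{d}V(X)$ for all vector fields $X$. $0_p$ is the zero vector of $T_pM$. Retraction. A retraction is a map $\phi$ from $TM$ to $M$ such that, writing $\phi_p$ for its restriction to $T_pM$: $\phi_p$ is smooth and defined on an open ball around $0_p$; $\phi_p(v)=p$ if and only if $v=0_p$; and $d\phi_p|_{0_p}=\mathrm{id}_{T_pM}$ (identifying $T_{0_p}T_pM\simeq T_pM$). For each $p$ fix an open neighbourhood $U_{p,\phi}\subset T_pM$ of $0_p$ such that $\phi_p:U_{p,\phi}\to\phi_p(U_{p,\phi})$ is a diffeomorphism; $\phi_p^{-1}:\phi_p(U_{p,\phi})\to U_{p,\phi}$ denotes its inverse. Discrete Riemannian gradient. Given $\phi$ and $c:M\times M\to M$ with $c(p,p)=p$, a discrete Riemannian gradient of $V$ is a continuous map $\overline{\mathrm{grad}}V:M\times M\to TM$ with $\overline{\mathrm{grad}}V(p,q)\in T_{c(p,q)}M$ such that (i) $V(q)-V(p)=g\big(\overline{\mathrm{grad}}V(p,q),\,\phi_{c(p,q)}^{-1}(q)-\phi_{c(p,q)}^{-1}(p)\big)$ for all $p,q\in M$ with $p,q\in\phi_{c(p,q)}(U_{c(p,q),\phi})$; and (ii) $\overline{\mathrm{grad}}V(p,p)=\mathrm{grad}V|_p$ for all $p\in M$. Standing assumption: for every $k$, $u^k$ and $u^{k+1}$ lie in $\phi_{c^k}(U_{c^k,\phi})$ and $W(u^k,u^{k+1})\in U_{c^k,\phi}$ (so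 that $\phi_{c^k}^{-1}(u^{k+1})=W(u^k,u^{k+1})$). The scheme is a discretization of the gradient flow $\dot u=-\mathrm{grad}V(u)$ with time steps $\tau_k$. *)

theory Defs
  imports "HOL-Analysis.Analysis" "HOL-Library.Function_Algebras"
begin

instantiation "fun" :: (type, real_vector) real_vector
begin

definition scaleR_fun :: "real \<Rightarrow> ('a \<Rightarrow> 'b) \<Rightarrow> 'a \<Rightarrow> 'b"
  where "scaleR_fun a f = (\<lambda>x. a *\<^sub>R f x)"

instance
  by standard (auto simp: scaleR_fun_def fun_eq_iff scaleR_add_right scaleR_add_left)

end

primrec times_differentiable_on ::
    "nat \<Rightarrow> 'a::real_normed_vector set \<Rightarrow> ('a \<Rightarrow> 'b::real_normed_vector) \<Rightarrow> bool"
  where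
    "times_differentiable_on 0 S f \<longleftrightarrow> continuous_on S f"
  | "times_differentiable_on (Suc n) S f \<longleftrightarrow>
       (\<forall>x\<in>S. f differentiable (at x)) \<and>
       (\<forall>v. times_differentiable_on n S (\<lambda>x. frechet_derivative f (at x) v))"

text \<open>Only used for open \<open>S\<close> in a finite-dimensional space, where continuity of all
  directional derivatives amounts to continuity of the derivative.\<close>

definition smooth_on ::
    "'a::real_normed_vector set \<Rightarrow> ('a \<Rightarrow> 'b::real_normed_vector) \<Rightarrow> bool"
  where "smooth_on S f \<longleftrightarrow> (\<forall>n. times_differentiable_on n S f)"

text \<open>A chart is a pair of its domain and its coordinate map; values of the coordinate map
  outside of the domain are irrelevant.\<close>

type_synonym ('m, 'e) chart = "'m set \<times> ('m \<Rightarrow> 'e)"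

definition chart_inv :: "('m, 'e) chart \<Rightarrow> 'e \<Rightarrow> 'm"
  where "chart_inv c = inv_into (fst c) (snd c)"

definition transition :: "('m, 'e) chart \<Rightarrow> ('m, 'e) chart \<Rightarrow> 'e \<Rightarrow> 'e"
  where "transition c d = snd d \<circ> chart_inv c"

definition is_chart :: "'m topology \<Rightarrow> ('m, 'e::real_normed_vector) chart \<Rightarrow> bool"
  where "is_chart X c \<longleftrightarrow>
    openin X (fst c) \<and> open (snd c ` fst c) \<and>
    homeomorphic_map (subtopology X (fst c)) (top_of_set (snd c ` fst c)) (snd c)"

definition smooth_atlas :: "'m topology \<Rightarrow> ('m, 'e::real_normed_vector) chart set \<Rightarrow> bool"
  where "smooth_atlas X A \<longleftrightarrow>
    (\<forall>c\<in>A. is_chart X c) \<and> \<Union>(fst ` A) = topspace X \<and>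
    (\<forall>c\<in>A. \<forall>d\<in>A. smooth_on (snd c ` (fst c \<inter> fst d)) (transition c d))"

text \<open>The model space is an arbitrary finite-dimensional normed space rather than a
  \<open>euclidean_space\<close>, since the latter class excludes dimension 0.\<close>

definition smooth_manifold :: "'m topology \<Rightarrow> ('m, 'e::real_normed_vector) chart set \<Rightarrow> bool"
  where "smooth_manifold X A \<longleftrightarrow>
    (\<exists>B::'e set. finite B \<and> span B = UNIV) \<and>
    Hausdorff_space X \<and> second_countable X \<and> smooth_atlas X A"

definition charts_at :: "('m, 'e) chart set \<Rightarrow> 'm \<Rightarrow> ('m, 'e) chart set"
  where "charts_at A p = {c \<in> A. p \<in> fst c}"

definition some_chart :: "('m, 'e) chart set \<Rightarrow> 'm \<Rightarrow> ('m, 'e) chart"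
  where "some_chart A p = (SOME c. c \<in> charts_at A p)"

definition smooth_map_on ::
    "'m topology \<Rightarrow> ('m, 'e::real_normed_vector) chart set \<Rightarrow>
     'n topology \<Rightarrow> ('n, 'f::real_normed_vector) chart set \<Rightarrow> 'm set \<Rightarrow> ('m \<Rightarrow> 'n) \<Rightarrow> bool"
  where "smooth_map_on X A Y B S f \<longleftrightarrow>
    openin X S \<and> continuous_map (subtopology X S) Y f \<and>
    (\<forall>c\<in>A. \<forall>d\<in>B. smooth_on (snd c ` {p \<in> S \<inter> fst c. f p \<in> fst d}) (snd d \<circ> f \<circ> chart_inv c))"

definition diffeomorphism_on ::
    "'m topology \<Rightarrow> ('m, 'e::real_normed_vector) chart set \<Rightarrow>
     'n topology \<Rightarrow> ('n, 'f::real_normed_vector) chart set \<Rightarrow> 'm set \<Rightarrow> ('m \<Rightarrow> 'n) \<Rightarrow> bool"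
  where "diffeomorphism_on X A Y B S f \<longleftrightarrow>
    inj_on f S \<and> smooth_map_on X A Y B S f \<and> smooth_map_on Y B X A (f ` S) (inv_into S f)"

text \<open>A tangent vector at \<open>p\<close> is the family of its coordinate vectors in all charts around \<open>p\<close>,
  related by the derivatives of the transition maps. The components at all other charts are set
  to 0, so that the pointwise operations are the vector space operations of the tangent space.\<close>

type_synonym ('m, 'e) tvec = "('m, 'e) chart \<Rightarrow> 'e"

definition tangent_space ::
    "('m, 'e::real_normed_vector) chart set \<Rightarrow> 'm \<Rightarrow> ('m, 'e) tvec set"
  where "tangent_space A p =
    {v. (\<forall>c \<in> charts_at A p. \<forall>d \<in> charts_at A p.
           v d = frechet_derivative (transition c d) (at (snd c p)) (v c)) \<and>
        (\<forall>c. c \<notin> charts_at A p \<longrightarrow> v c = 0)}"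

definition tangent_bundle ::
    "'m topology \<Rightarrow> ('m, 'e::real_normed_vector) chart set \<Rightarrow> ('m \<times> ('m, 'e) tvec) set"
  where "tangent_bundle X A = (SIGMA p : topspace X. tangent_space A p)"

text \<open>The topology making every bundle chart \<open>(p, v) \<mapsto> (x(p), v\<^sub>c)\<close>, for \<open>c = (W, x)\<close> in the
  atlas, a homeomorphism from the part of the tangent bundle over \<open>W\<close> onto \<open>x(W) \<times> E\<close>, where
  \<open>E\<close> is the model space.\<close>

definition tangent_bundle_topology ::
    "'m topology \<Rightarrow> ('m, 'e::real_normed_vector) chart set \<Rightarrow> ('m \<times> ('m, 'e) tvec) topology"
  where "tangent_bundle_topology X A = topology_generated_by
    {{(p, v) \<in> tangent_bundle X A. p \<in> fst c \<and> (snd c p, v c) \<in> Q} | c Q. c \<in> A \<and> open Q}"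

text \<open>The tangent space as a manifold. The subspace topology of the pointwise topology is the
  usual topology of this finite-dimensional space, and each \<open>v \<mapsto> v c\<close> is a global linear chart.\<close>

definition tangent_space_topology ::
    "('m, 'e::real_normed_vector) chart set \<Rightarrow> 'm \<Rightarrow> ('m, 'e) tvec topology"
  where "tangent_space_topology A p = top_of_set (tangent_space A p)"

definition tangent_space_atlas ::
    "('m, 'e::real_normed_vector) chart set \<Rightarrow> 'm \<Rightarrow> (('m, 'e) tvec, 'e) chart set"
  where "tangent_space_atlas A p = (\<lambda>c. (tangent_space A p, \<lambda>v. v c)) ` charts_at A p"

text \<open>The identification of the tangent space at \<open>p\<close> with its own tangent space at 0: in a
  linear chart, the coordinate vector of the image of \<open>v\<close> is the coordinate of the point \<open>v\<close>.\<close>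

definition tangent_space_ident ::
    "('m, 'e::real_normed_vector) chart set \<Rightarrow> 'm \<Rightarrow> ('m, 'e) tvec \<Rightarrow> (('m, 'e) tvec, 'e) tvec"
  where "tangent_space_ident A p v = (\<lambda>c. if c \<in> tangent_space_atlas A p then snd c v else 0)"

text \<open>The value does not depend on the chart chosen around \<open>p\<close>, here and for
  \<open>function_differential\<close> below.\<close>

definition differential ::
    "('m, 'e::real_normed_vector) chart set \<Rightarrow> ('n, 'f::real_normed_vector) chart set \<Rightarrow>
     ('m \<Rightarrow> 'n) \<Rightarrow> 'm \<Rightarrow> ('m, 'e) tvec \<Rightarrow> ('n, 'f) tvec"
  where "differential A B f p v =
    (let c = some_chart A p in
     (\<lambda>d. if d \<in> charts_at B (f p)
          then frechet_derivative (snd d \<circ> f \<circ> chart_inv c) (at (snd c p)) (v c) else 0))"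

definition differentiable_function ::
    "'m topology \<Rightarrow> ('m, 'e::real_normed_vector) chart set \<Rightarrow> ('m \<Rightarrow> real) \<Rightarrow> bool"
  where "differentiable_function X A V \<longleftrightarrow>
    (\<forall>p\<in>topspace X. \<forall>c \<in> charts_at A p. (V \<circ> chart_inv c) differentiable (at (snd c p)))"

definition function_differential ::
    "('m, 'e::real_normed_vector) chart set \<Rightarrow> ('m \<Rightarrow> real) \<Rightarrow> 'm \<Rightarrow> ('m, 'e) tvec \<Rightarrow> real"
  where "function_differential A V p v =
    (let c = some_chart A p in frechet_derivative (V \<circ> chart_inv c) (at (snd c p)) (v c))"

definition inner_product_on :: "'v::real_vector set \<Rightarrow> ('v \<Rightarrow> 'v \<Rightarrow> real) \<Rightarrow> bool"
  where "inner_product_on T h \<longleftrightarrow>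
    (\<forall>v\<in>T. \<forall>w\<in>T. h v w = h w v) \<and>
    (\<forall>u\<in>T. \<forall>v\<in>T. \<forall>w\<in>T. h (u + v) w = h u w + h v w) \<and>
    (\<forall>a. \<forall>v\<in>T. \<forall>w\<in>T. h (a *\<^sub>R v) w = a * h v w) \<and>
    (\<forall>v\<in>T. v \<noteq> 0 \<longrightarrow> 0 < h v v)"

text \<open>The tangent vector at \<open>p\<close> with coordinate vector \<open>a\<close> in the chart \<open>c\<close>.\<close>

definition coordinate_vector ::
    "('m, 'e::real_normed_vector) chart set \<Rightarrow> ('m, 'e) chart \<Rightarrow> 'e \<Rightarrow> 'm \<Rightarrow> ('m, 'e) tvec"
  where "coordinate_vector A c a p =
    (\<lambda>d. if d \<in> charts_at A p then frechet_derivative (transition c d) (at (snd c p)) a else 0)"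

type_synonym ('m, 'e) metric_tensor = "'m \<Rightarrow> ('m, 'e) tvec \<Rightarrow> ('m, 'e) tvec \<Rightarrow> real"

definition riemannian_metric ::
    "'m topology \<Rightarrow> ('m, 'e::real_normed_vector) chart set \<Rightarrow> ('m, 'e) metric_tensor \<Rightarrow> bool"
  where "riemannian_metric X A g \<longleftrightarrow>
    (\<forall>p\<in>topspace X. inner_product_on (tangent_space A p) (g p)) \<and>
    (\<forall>c\<in>A. \<forall>a b. smooth_on (snd c ` fst c)
       ((\<lambda>p. g p (coordinate_vector A c a p) (coordinate_vector A c b p)) \<circ> chart_inv c))"

definition riemannian_manifold ::
    "'m topology \<Rightarrow> ('m, 'e::real_normed_vector) chart set \<Rightarrow> ('m, 'e) metric_tensor \<Rightarrow> bool"
  where "riemannian_manifold X A g \<longleftrightarrow> smooth_manifold X A \<and> riemannian_metric X A g"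

definition riemannian_gradient ::
    "('m, 'e::real_normed_vector) chart set \<Rightarrow> ('m, 'e) metric_tensor \<Rightarrow> ('m \<Rightarrow> real) \<Rightarrow>
     'm \<Rightarrow> ('m, 'e) tvec"
  where "riemannian_gradient A g V p =
    (THE w. w \<in> tangent_space A p \<and>
            (\<forall>v \<in> tangent_space A p. g p w v = function_differential A V p v))"

definition tangent_ball ::
    "('m, 'e::real_normed_vector) chart set \<Rightarrow> ('m, 'e) metric_tensor \<Rightarrow> 'm \<Rightarrow> real \<Rightarrow>
     ('m, 'e) tvec set"
  where "tangent_ball A g p r = {v \<in> tangent_space A p. sqrt (g p v v) < r}"

text \<open>A retraction may be defined only on part of the tangent bundle; \<open>D p\<close> is the domain of
  \<open>\<phi> p\<close>, and values of \<open>\<phi> p\<close> outside of it are irrelevant.\<close>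

definition manifold_retraction ::
    "'m topology \<Rightarrow> ('m, 'e::real_normed_vector) chart set \<Rightarrow> ('m, 'e) metric_tensor \<Rightarrow>
     ('m \<Rightarrow> ('m, 'e) tvec set) \<Rightarrow> ('m \<Rightarrow> ('m, 'e) tvec \<Rightarrow> 'm) \<Rightarrow> bool"
  where "manifold_retraction X A g D \<phi> \<longleftrightarrow>
    (\<forall>p\<in>topspace X.
       D p \<subseteq> tangent_space A p \<and> \<phi> p ` D p \<subseteq> topspace X \<and>
       (\<exists>r>0. tangent_ball A g p r \<subseteq> D p \<and>
          smooth_map_on (tangent_space_topology A p) (tangent_space_atlas A p) X A
            (tangent_ball A g p r) (\<phi> p)) \<and>
       (\<forall>v\<in>D p. \<phi> p v = p \<longleftrightarrow> v = 0) \<and>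
       (\<forall>v\<in>tangent_space A p.
          differential (tangent_space_atlas A p) A (\<phi> p) 0 (tangent_space_ident A p v) = v))"

definition retraction_neighbourhoods ::
    "'m topology \<Rightarrow> ('m, 'e::real_normed_vector) chart set \<Rightarrow>
     ('m \<Rightarrow> ('m, 'e) tvec set) \<Rightarrow> ('m \<Rightarrow> ('m, 'e) tvec \<Rightarrow> 'm) \<Rightarrow>
     ('m \<Rightarrow> ('m, 'e) tvec set) \<Rightarrow> bool"
  where "retraction_neighbourhoods X A D \<phi> U \<longleftrightarrow>
    (\<forall>p\<in>topspace X. 0 \<in> U p \<and> U p \<subseteq> D p \<and> openin (tangent_space_topology A p) (U p) \<and>
       diffeomorphism_on (tangent_space_topology A p) (tangent_space_atlas A p) X A (U p) (\<phi> p))"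

definition retraction_inv ::
    "('m \<Rightarrow> ('m, 'e) tvec \<Rightarrow> 'm) \<Rightarrow> ('m \<Rightarrow> ('m, 'e) tvec set) \<Rightarrow> 'm \<Rightarrow> 'm \<Rightarrow> ('m, 'e) tvec"
  where "retraction_inv \<phi> U p = inv_into (U p) (\<phi> p)"

text \<open>\<open>G p q\<close> is the fibre part of the discrete gradient; as a map into the tangent bundle the
  discrete gradient is \<open>(p, q) \<mapsto> (c p q, G p q)\<close>.\<close>

definition discrete_riemannian_gradient ::
    "'m topology \<Rightarrow> ('m, 'e::real_normed_vector) chart set \<Rightarrow> ('m, 'e) metric_tensor \<Rightarrow>
     ('m \<Rightarrow> ('m, 'e) tvec \<Rightarrow> 'm) \<Rightarrow> ('m \<Rightarrow> ('m, 'e) tvec set) \<Rightarrow> ('m \<Rightarrow> 'm \<Rightarrow> 'm) \<Rightarrow>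
     ('m \<Rightarrow> real) \<Rightarrow> ('m \<Rightarrow> 'm \<Rightarrow> ('m, 'e) tvec) \<Rightarrow> bool"
  where "discrete_riemannian_gradient X A g \<phi> U c V G \<longleftrightarrow>
    (\<forall>p\<in>topspace X. \<forall>q\<in>topspace X. G p q \<in> tangent_space A (c p q)) \<and>
    continuous_map (prod_topology X X) (tangent_bundle_topology X A) (\<lambda>(p, q). (c p q, G p q)) \<and>
    (\<forall>p\<in>topspace X. \<forall>q\<in>topspace X.
       p \<in> \<phi> (c p q) ` U (c p q) \<longrightarrow> q \<in> \<phi> (c p q) ` U (c p q) \<longrightarrow>
       V q - V p =
         g (c p q) (G p q) (retraction_inv \<phi> U (c p q) q - retraction_inv \<phi> U (c p q) p)) \<and>
    (\<forall>p\<in>topspace X. G p p = riemannian_gradient A g V p)"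

text \<open>The vector \<open>W(p, q)\<close> of the discrete Riemannian gradient scheme with step size \<open>t\<close>.\<close>

definition scheme_vector ::
    "('m \<Rightarrow> ('m, 'e::real_normed_vector) tvec \<Rightarrow> 'm) \<Rightarrow> ('m \<Rightarrow> ('m, 'e) tvec set) \<Rightarrow>
     ('m \<Rightarrow> 'm \<Rightarrow> 'm) \<Rightarrow> ('m \<Rightarrow> 'm \<Rightarrow> ('m, 'e) tvec) \<Rightarrow> real \<Rightarrow> 'm \<Rightarrow> 'm \<Rightarrow> ('m, 'e) tvec"
  where "scheme_vector \<phi> U c G t p q = retraction_inv \<phi> U (c p q) p - t *\<^sub>R G p q"

end

theory Submission
  imports Defs
begin

text \<open>By the choice of the scheme, the difference of the two points read in the retraction at
  \<open>c\<^sup>k\<close> is \<open>- \<tau>\<^sub>k\<close> times the discrete gradient, so that the mean value identity (i) turns the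
  increment of \<open>V\<close> into \<open>- \<tau>\<^sub>k\<close> times a squared norm.\<close>

text \<open>Smoothness of the atlas already contains first-order differentiability on the overlap,
  which contains \<open>p\<close>. This makes \<open>frechet_derivative\<close> a genuine linear map
  here rather than an unspecified choice.\<close>

lemma transition_differentiable:
  assumes "smooth_atlas X A" "c \<in> charts_at A p" "d \<in> charts_at A p"
  shows "transition c d differentiable (at (snd c p))"
proof -
  have "times_differentiable_on (Suc 0) (snd c ` (fst c \<inter> fst d)) (transition c d)"
    using assms unfolding smooth_atlas_def charts_at_def smooth_on_def by blast
  then show ?thesis
    using assms unfolding charts_at_def by auto
qed

text \<open>Derivatives of transition maps are linear, so they commute with scaling the coordinate
  vectors. Closure is needed because the laws of the metric hold only for arguments inside the
  tangent space.\<close>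

lemma tangent_space_scaleR:
  assumes "smooth_atlas X A" "v \<in> tangent_space A p"
  shows "a *\<^sub>R v \<in> tangent_space A p"
proof -
  have coord: "a *\<^sub>R v d = frechet_derivative (transition c d) (at (snd c p)) (a *\<^sub>R v c)"
    if "c \<in> charts_at A p" "d \<in> charts_at A p" for c d
  proof -
    have "linear (frechet_derivative (transition c d) (at (snd c p)))"
      using transition_differentiable[OF assms(1) that] by (rule linear_frechet_derivative)
    moreover have "v d = frechet_derivative (transition c d) (at (snd c p)) (v c)"
      using assms(2) that unfolding tangent_space_def by blast
    ultimately show ?thesis
      by (simp add: linear_scale)
  qed
  have zero: "a *\<^sub>R v c = 0" if "c \<notin> charts_at A p" for c
  proof -
    have "v c = 0"
      using assms(2) that unfolding tangent_space_def by blast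
    then show ?thesis
      by simp
  qed
  show ?thesis
    unfolding tangent_space_def scaleR_fun_def mem_Collect_eq
    by (intro conjI ballI allI impI coord zero)
qed

lemma inner_product_onD:
  assumes "inner_product_on T h"
  shows inner_product_on_commute: "v \<in> T \<Longrightarrow> w \<in> T \<Longrightarrow> h v w = h w v"
    and inner_product_on_scaleR_left: "v \<in> T \<Longrightarrow> w \<in> T \<Longrightarrow> h (a *\<^sub>R v) w = a * h v w"
    and inner_product_on_pos: "v \<in> T \<Longrightarrow> v \<noteq> 0 \<Longrightarrow> 0 < h v v"
proof -
  have "\<forall>v\<in>T. \<forall>w\<in>T. h v w = h w v"
    and "\<forall>a. \<forall>v\<in>T. \<forall>w\<in>T. h (a *\<^sub>R v) w = a * h v w"
    and "\<forall>v\<in>T. v \<noteq> 0 \<longrightarrow> 0 < h v v"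
    using assms unfolding inner_product_on_def by - (elim conjE, assumption)+
  then show "v \<in> T \<Longrightarrow> w \<in> T \<Longrightarrow> h v w = h w v"
    and "v \<in> T \<Longrightarrow> w \<in> T \<Longrightarrow> h (a *\<^sub>R v) w = a * h v w"
    and "v \<in> T \<Longrightarrow> v \<noteq> 0 \<Longrightarrow> 0 < h v v"
    by metis+
qed

text \<open>Homogeneity is given in the first argument only and is carried over by symmetry. Since
  \<open>T\<close> is an arbitrary set, membership of the scaled vector has to be supplied
  separately.\<close>

lemma inner_product_on_scaleR_right:
  assumes "inner_product_on T h" "v \<in> T" "w \<in> T" "a *\<^sub>R w \<in> T"
  shows "h v (a *\<^sub>R w) = a * h v w"
  using inner_product_on_commute[OF assms(1,2,4)] inner_product_on_commute[OF assms(1-3)]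
    inner_product_on_scaleR_left[OF assms(1,3,2)]
  by metis

lemma inner_product_on_nonneg:
  assumes "inner_product_on T h" "v \<in> T"
  shows "0 \<le> h v v"
proof (cases "v = 0")
  case True
  then show ?thesis
    \<comment> \<open>Positivity says nothing at 0; homogeneity with scalar 0 gives
      \<open>h 0 0 = 0\<close>.\<close>
    using inner_product_on_scaleR_left[OF assms assms(2), of 0] by simp
next
  case False
  then show ?thesis
    using inner_product_on_pos[OF assms] by simp
qed

theorem proposition1:
  fixes X :: "'m topology"
    and A :: "('m, 'e::real_normed_vector) chart set"
    and g :: "('m, 'e) metric_tensor"
    and D U :: "'m \<Rightarrow> ('m, 'e) tvec set"
    and \<phi> :: "'m \<Rightarrow> ('m, 'e) tvec \<Rightarrow> 'm"
    and c :: "'m \<Rightarrow> 'm \<Rightarrow> 'm"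
    and V :: "'m \<Rightarrow> real"
    and G :: "'m \<Rightarrow> 'm \<Rightarrow> ('m, 'e) tvec"
    and \<tau> :: "nat \<Rightarrow> real"
    and u :: "nat \<Rightarrow> 'm"
  assumes "riemannian_manifold X A g"
    and "manifold_retraction X A g D \<phi>"
    and "retraction_neighbourhoods X A D \<phi> U"
    and "\<And>p q. p \<in> topspace X \<Longrightarrow> q \<in> topspace X \<Longrightarrow> c p q \<in> topspace X"
    and "\<And>p. p \<in> topspace X \<Longrightarrow> c p p = p"
    and "differentiable_function X A V"
    and "discrete_riemannian_gradient X A g \<phi> U c V G"
    and "\<And>k. \<tau> k > 0"
    and "\<And>k. u k \<in> topspace X"
    and "\<And>k. u k \<in> \<phi> (c (u k) (u (Suc k))) ` U (c (u k) (u (Suc k)))"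
    and "\<And>k. u (Suc k) \<in> \<phi> (c (u k) (u (Suc k))) ` U (c (u k) (u (Suc k)))"
    and "\<And>k. scheme_vector \<phi> U c G (\<tau> k) (u k) (u (Suc k)) \<in> U (c (u k) (u (Suc k)))"
    and "\<And>k. u (Suc k) =
           \<phi> (c (u k) (u (Suc k))) (scheme_vector \<phi> U c G (\<tau> k) (u k) (u (Suc k)))"
  shows "\<forall>k. V (u (Suc k)) - V (u k) \<le> 0"
proof
  fix k
  define p q where "p = u k" and "q = u (Suc k)"
  have X: "p \<in> topspace X" "q \<in> topspace X"
    using assms(9) by (simp_all add: p_def q_def)
  have atlas: "smooth_atlas X A"
    using assms(1) unfolding riemannian_manifold_def smooth_manifold_def by blast
  have inner: "inner_product_on (tangent_space A (c p q)) (g (c p q))"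
    using assms(1) assms(4)[OF X] unfolding riemannian_manifold_def riemannian_metric_def by blast
  have G: "G p q \<in> tangent_space A (c p q)"
    using assms(7) X unfolding discrete_riemannian_gradient_def by blast
  \<comment> \<open>\<open>retraction_inv\<close> is an \<open>inv_into\<close>, so injectivity on
    \<open>U (c p q)\<close> is what makes it a left inverse at the scheme vector.\<close>
  have "inj_on (\<phi> (c p q)) (U (c p q))"
    using assms(3) assms(4)[OF X]
    unfolding retraction_neighbourhoods_def diffeomorphism_on_def by blast
  moreover have "scheme_vector \<phi> U c G (\<tau> k) p q \<in> U (c p q)"
    using assms(12)[of k] by (simp add: p_def q_def)
  ultimately have
    "retraction_inv \<phi> U (c p q) (\<phi> (c p q) (scheme_vector \<phi> U c G (\<tau> k) p q)) =
      scheme_vector \<phi> U c G (\<tau> k) p q"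
    unfolding retraction_inv_def by (rule inv_into_f_f)
  \<comment> \<open>The scheme is implicit: \<open>q\<close> stands on both sides of its equation.
    Rewriting from right to left collapses the retracted vector to \<open>q\<close>, whereas the
    other direction would loop.\<close>
  then have "retraction_inv \<phi> U (c p q) q = scheme_vector \<phi> U c G (\<tau> k) p q"
    unfolding assms(13)[of k, folded p_def q_def, symmetric] .
  then have diff: "retraction_inv \<phi> U (c p q) q - retraction_inv \<phi> U (c p q) p = (- \<tau> k) *\<^sub>R G p q"
    by (simp add: scheme_vector_def)
  \<comment> \<open>The identity is available only when both points lie in the image of
    \<open>U (c p q)\<close>, as the standing assumption on the iterates guarantees.\<close>
  have "V q - V p =
      g (c p q) (G p q) (retraction_inv \<phi> U (c p q) q - retraction_inv \<phi> U (c p q) p)"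
    using assms(7) X assms(10,11)[of k, folded p_def q_def]
    unfolding discrete_riemannian_gradient_def by blast
  also have "\<dots> = - \<tau> k * g (c p q) (G p q) (G p q)"
    unfolding diff
    using inner_product_on_scaleR_right[OF inner G G tangent_space_scaleR[OF atlas G]] .
  also have "\<dots> \<le> 0"
    using inner_product_on_nonneg[OF inner G] assms(8)[of k] by simp
  finally show "V (u (Suc k)) - V (u k) \<le> 0"
    by (simp add: p_def q_def)
qed

end
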